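(* Let a formal deformation, to lowest order in $\hbar$, of the differential calculus on a smooth manifold $M$ be given (see context), with Poisson bracket $\{\ ,\ \}$ and preconnection $\gamma$. Then for all $x,y\in C^\infty(M)$ and $\tau\in\Omega^1(M)$, $$[x,[y,\tau]_\bullet]_\bullet+[\tau,[x,y]_\bullet]_\bullet+[y,[\tau,x]_\bullet]_\bullet=\hbar^2\,R(\hat x,\hat y)(\tau)+O(\hbar^3),$$ i.e. the obstruction to the first super Jacobi identity is $J_1(x,y,z)=R(\hat x,\hat y)(\mathrm{d}z)$ for all $x,y,z\in C^\infty(M)$.
   Context: $\Omega^n(M)$ denotes the $n$-forms on $M$, $\Omega^0(M)=C^\infty(M)$. A formal deformation of the differential calculus on $M$ to lowest order in $\hbar$ consists of the following maps depending on a parameter $\hbar$ and admitting power series expansions in $\hbar$ (extended linearly in $\hbar$; $O(\hbar^k)$ denotes terms of order at least $k$ in $\hbar$): (i) an associative product $\bullet$ on $C^\infty(M)$ with $x\bullet y=xy+O(\hbar)$ and $x\bullet y-y\bullet x=\hbar\{x,y\}+O(\hbar^2)$ (so $\{\ ,\ \}$ is a Poisson bracket); (ii) products $x\bullet\tau$ and $\tau\bullet x$ for $x\in C^\infty(M)$, $\tau\in\Omega^1(M)$, both equal to $x\tau+O(\hbar)$, making $\Omega^1(M)$ a bimodule to order $O(\hbar^2)$: $(x\bullet y)\bullet\tau-x\bullet(y\bullet\tau)=O(\hbar^2)$, $\tau\bullet(x\bullet y)-(\tau\bullet x)\bullet y=O(\hbar^2)$, $(x\bullet\tau)\bullet y-x\bullet(\tau\bullet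 y)=O(\hbar^2)$; (iii) a deformed exterior product $\wedge_\bullet$ on forms, with $\tau\wedge_\bullet\eta=\tau\wedge\eta+O(\hbar)$, associative to $O(\hbar^2)$ (written $\bullet$ when one of the factors is a function); (iv) an operator $\mathrm{d}^\bullet:\Omega^n(M)\to\Omega^{n+1}(M)$ with $\mathrm{d}^\bullet=\mathrm{d}+O(\hbar)$ which is a graded derivation to order $O(\hbar^2)$. $[\ ,\ ]_\bullet$ is the super-commutator $[\xi,\eta]_\bullet=\xi\wedge_\bullet\eta-(-1)^{\deg\xi\deg\eta}\eta\wedge_\bullet\xi$. The preconnection $\gamma$ is defined by $[x,\tau]_\bullet=\hbar\,\gamma(x,\tau)+O(\hbar^2)$; one writes $\hat\nabla_x\tau=\gamma(x,\tau)$, and $\hat x=\{x,-\}$ for the Hamiltonian vector field. The curvature of the preconnection is $R(\hat x,\hat y)=\hat\nabla_x\hat\nabla_y-\hat\nabla_y\hat\nabla_x-\hat\nabla_{\{x,y\}}$ acting on $\Omega^1(M)$. The map $J_1:C^\infty(M)^{\otimes3}\to\Omega^1(M)$ is defined by $[x,[y,\mathrm{d}z]_\bullet]_\bullet+[\mathrm{d}z,[x,y]_\bullet]_\bullet+[y,[\mathrm{d}z,x]_\bullet]_\bullet=\hbar^2J_1(x,y,z)+O(\hbar^3)$. *)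

theory Defs
  imports
    "HOL-Analysis.Analysis"
    "HOL-Computational_Algebra.Formal_Power_Series"
    "HOL-Library.Function_Algebras"
begin

text \<open>
  Functions, vector fields and forms are added, subtracted and multiplied through the pointwise
  instances of \<open>Function_Algebras\<close>. Functions on \<open>M\<close> are taken to be \<open>0\<close> off \<open>topspace (mtop M)\<close>,
  and vector fields and forms to be \<open>0\<close> off their proper domains, so that HOL equality is equality
  of the mathematical objects.
\<close>


section \<open>Smooth manifolds\<close>

text \<open>
  \<open>smooth_upto k n V f\<close>: all iterated partial derivatives of \<open>f\<close> of order at most \<open>k\<close> exist and are
  continuous on \<open>V\<close>, an open subset of \<open>Euclidean_space n\<close> (which is \<open>\<real>\<^sup>n\<close>, realised as the sequences
  that vanish from index \<open>n\<close> on).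
\<close>

primrec smooth_upto ::
    "nat \<Rightarrow> nat \<Rightarrow> (nat \<Rightarrow> real) set \<Rightarrow> ((nat \<Rightarrow> real) \<Rightarrow> real) \<Rightarrow> bool" where
  "smooth_upto 0 n V f \<longleftrightarrow> continuous_map (subtopology (Euclidean_space n) V) euclideanreal f"
| "smooth_upto (Suc k) n V f \<longleftrightarrow>
     continuous_map (subtopology (Euclidean_space n) V) euclideanreal f \<and>
     (\<forall>i<n. (\<forall>x\<in>V. (\<lambda>t. f (x(i := t))) field_differentiable at (x i)) \<and>
            smooth_upto k n V (\<lambda>x. deriv (\<lambda>t. f (x(i := t))) (x i)))"

definition smooth_in :: "nat \<Rightarrow> (nat \<Rightarrow> real) set \<Rightarrow> ((nat \<Rightarrow> real) \<Rightarrow> real) \<Rightarrow> bool" where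
  "smooth_in n V f \<longleftrightarrow> (\<forall>k. smooth_upto k n V f)"

record 'a manifold =
  mtop :: "'a topology"
  mdim :: nat
  atlas :: "('a set \<times> ('a \<Rightarrow> nat \<Rightarrow> real)) set"

definition is_chart :: "'a manifold \<Rightarrow> 'a set \<times> ('a \<Rightarrow> nat \<Rightarrow> real) \<Rightarrow> bool" where
  "is_chart M = (\<lambda>(U, \<phi>). openin (mtop M) U \<and> openin (Euclidean_space (mdim M)) (\<phi> ` U) \<and>
     homeomorphic_map (subtopology (mtop M) U)
       (subtopology (Euclidean_space (mdim M)) (\<phi> ` U)) \<phi>)"

text \<open>The atlas is not required to be maximal; smooth functions only depend on the maximal atlas.\<close>

definition smooth_manifold :: "'a manifold \<Rightarrow> bool" where
  "smooth_manifold M \<longleftrightarrow>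
     Hausdorff_space (mtop M) \<and> second_countable (mtop M) \<and>
     (\<forall>c\<in>atlas M. is_chart M c) \<and>
     (\<Union>(U, \<phi>)\<in>atlas M. U) = topspace (mtop M) \<and>
     (\<forall>(U, \<phi>)\<in>atlas M. \<forall>(U', \<phi>')\<in>atlas M. \<forall>i<mdim M.
        smooth_in (mdim M) (\<phi> ` (U \<inter> U')) (\<lambda>u. \<phi>' (inv_into U \<phi> u) i))"

definition smooth_functions :: "'a manifold \<Rightarrow> ('a \<Rightarrow> real) set" where
  "smooth_functions M = {f.
     (\<forall>(U, \<phi>)\<in>atlas M. smooth_in (mdim M) (\<phi> ` U) (\<lambda>u. f (inv_into U \<phi> u))) \<and>
     (\<forall>p. p \<notin> topspace (mtop M) \<longrightarrow> f p = 0)}"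


section \<open>Vector fields and differential forms\<close>

text \<open>Vector fields are the derivations of the real algebra of smooth functions.\<close>

type_synonym 'a vfield = "('a \<Rightarrow> real) \<Rightarrow> 'a \<Rightarrow> real"

definition vector_fields :: "'a manifold \<Rightarrow> 'a vfield set" where
  "vector_fields M = {v.
     (\<forall>f\<in>smooth_functions M. v f \<in> smooth_functions M) \<and>
     (\<forall>f. f \<notin> smooth_functions M \<longrightarrow> v f = 0) \<and>
     (\<forall>f\<in>smooth_functions M. \<forall>g\<in>smooth_functions M. \<forall>r.
        v (\<lambda>p. r * f p + g p) = (\<lambda>p. r * v f p + v g p)) \<and>
     (\<forall>f\<in>smooth_functions M. \<forall>g\<in>smooth_functions M. v (f * g) = v f * g + f * v g)}"

definition lie_bracket :: "'a vfield \<Rightarrow> 'a vfield \<Rightarrow> 'a vfield" where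
  "lie_bracket v w = (\<lambda>f. v (w f) - w (v f))"

text \<open>
  An \<open>n\<close>-form is an alternating map, multilinear over the smooth functions, from \<open>n\<close>-tuples of
  vector fields to smooth functions; tuples are lists. In particular \<open>\<Omega>\<^sup>0\<close> is identified with the
  smooth functions through \<open>\<omega> \<mapsto> \<omega> []\<close> (see \<open>bij_betw_forms_0\<close> below).
\<close>

type_synonym 'a form = "'a vfield list \<Rightarrow> 'a \<Rightarrow> real"

definition forms :: "'a manifold \<Rightarrow> nat \<Rightarrow> 'a form set" where
  "forms M n = {\<omega>.
     (\<forall>vs. length vs = n \<and> set vs \<subseteq> vector_fields M \<longrightarrow> \<omega> vs \<in> smooth_functions M) \<and>
     (\<forall>vs. \<not> (length vs = n \<and> set vs \<subseteq> vector_fields M) \<longrightarrow> \<omega> vs = 0) \<and>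
     (\<forall>vs. length vs = n \<and> set vs \<subseteq> vector_fields M \<longrightarrow>
        (\<forall>i<n. \<forall>v\<in>vector_fields M. \<forall>w\<in>vector_fields M. \<forall>f\<in>smooth_functions M.
           \<omega> (vs[i := (\<lambda>g. f * v g + w g)]) = f * \<omega> (vs[i := v]) + \<omega> (vs[i := w]))) \<and>
     (\<forall>vs. \<not> distinct vs \<longrightarrow> \<omega> vs = 0)}"

lemma bij_betw_forms_0: "bij_betw (\<lambda>\<omega>. \<omega> []) (forms M 0) (smooth_functions M)"
proof (rule bij_betw_byWitness[where f' = "\<lambda>f vs. if vs = [] then f else 0"])
  show "\<forall>\<omega>\<in>forms M 0. (\<lambda>vs. if vs = [] then \<omega> [] else 0) = \<omega>"
    by (auto simp: forms_def fun_eq_iff)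
qed (auto simp: forms_def)

text \<open>
  The exterior product, as the signed sum over shuffles: \<open>S\<close> is the set of positions fed to \<open>\<tau>\<close>,
  and the exponent counts the inversions of the corresponding shuffle. Subsets \<open>S\<close> of the
  wrong size contribute \<open>0\<close> as forms vanish on lists of the wrong length.
\<close>

definition wedge :: "'a form \<Rightarrow> 'a form \<Rightarrow> 'a form" where
  "wedge \<tau> \<eta> = (\<lambda>vs p. \<Sum>S\<in>Pow {..<length vs}.
     (- 1) ^ card {(i, j). i \<in> S \<and> j \<in> {..<length vs} - S \<and> j < i} *
       \<tau> (nths vs S) p * \<eta> (nths vs (- S)) p)"

text \<open>The exterior derivative, by the invariant (Koszul) formula.\<close>

definition ext_d :: "'a manifold \<Rightarrow> 'a form \<Rightarrow> 'a form" where
  "ext_d M \<omega> = (\<lambda>vs p. if set vs \<subseteq> vector_fields M then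
     (\<Sum>i<length vs. (- 1) ^ i * (vs ! i) (\<omega> (nths vs (- {i}))) p) +
     (\<Sum>j<length vs. \<Sum>i<j.
        (- 1) ^ (i + j) * \<omega> (lie_bracket (vs ! i) (vs ! j) # nths vs (- {i, j})) p)
     else 0)"


section \<open>Formal deformations of the differential calculus\<close>

text \<open>
  Power series in \<open>\<hbar>\<close> with form coefficients are elements of \<open>'a form fps\<close>. \<open>hbar k \<omega>\<close> is
  \<open>\<hbar>\<^sup>k \<omega>\<close>, and \<open>eq_upto k a b\<close> is \<open>a = b + O(\<hbar>\<^sup>k)\<close>.
\<close>

definition hbar :: "nat \<Rightarrow> 'a form \<Rightarrow> 'a form fps" where
  "hbar k \<omega> = Abs_fps (\<lambda>j. if j = k then \<omega> else 0)"

abbreviation cst :: "'a form \<Rightarrow> 'a form fps" where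
  "cst \<equiv> hbar 0"

definition eq_upto :: "nat \<Rightarrow> 'a form fps \<Rightarrow> 'a form fps \<Rightarrow> bool" where
  "eq_upto k a b \<longleftrightarrow> (\<forall>j<k. fps_nth a j = fps_nth b j)"

text \<open>\<open>\<hbar>\<close>-linear extensions of a product and of an operator from forms to power series.\<close>

definition ext_prod ::
    "('a form \<Rightarrow> 'a form \<Rightarrow> 'a form fps) \<Rightarrow> 'a form fps \<Rightarrow> 'a form fps \<Rightarrow> 'a form fps" where
  "ext_prod P a b = Abs_fps (\<lambda>n. \<Sum>i\<le>n. \<Sum>j\<le>n - i.
     fps_nth (P (fps_nth a i) (fps_nth b j)) (n - i - j))"

definition ext_op :: "('a form \<Rightarrow> 'a form fps) \<Rightarrow> 'a form fps \<Rightarrow> 'a form fps" where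
  "ext_op D a = Abs_fps (\<lambda>n. \<Sum>i\<le>n. fps_nth (D (fps_nth a i)) (n - i))"

definition scale_form :: "real \<Rightarrow> 'a form \<Rightarrow> 'a form" where
  "scale_form r \<omega> = (\<lambda>vs p. r * \<omega> vs p)"

definition scale_series :: "real \<Rightarrow> 'a form fps \<Rightarrow> 'a form fps" where
  "scale_series r a = Abs_fps (\<lambda>n. scale_form r (fps_nth a n))"

text \<open>
  A single product \<open>P\<close> carries all the deformed products: \<open>\<bullet>\<close> is \<open>\<and>\<^sub>\<bullet>\<close> with a factor in \<open>\<Omega>\<^sup>0\<close>.
  The instances of \<open>associative\<close> with two factors in \<open>\<Omega>\<^sup>0\<close> and one in \<open>\<Omega>\<^sup>1\<close> say that \<open>\<Omega>\<^sup>1\<close> is a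
  bimodule to order \<open>O(\<hbar>\<^sup>2)\<close>; on \<open>\<Omega>\<^sup>0\<close> the product is associative to all orders.
\<close>

locale calculus_deformation =
  fixes M :: "'a manifold"
    and P :: "'a form \<Rightarrow> 'a form \<Rightarrow> 'a form fps"
    and D :: "'a form \<Rightarrow> 'a form fps"
  assumes prod_closed:
      "\<lbrakk>\<tau> \<in> forms M p; \<eta> \<in> forms M q\<rbrakk> \<Longrightarrow> fps_nth (P \<tau> \<eta>) k \<in> forms M (p + q)"
    and prod_linear_left:
      "\<lbrakk>\<tau> \<in> forms M p; \<tau>' \<in> forms M p; \<eta> \<in> forms M q\<rbrakk>
        \<Longrightarrow> P (scale_form r \<tau> + \<tau>') \<eta> = scale_series r (P \<tau> \<eta>) + P \<tau>' \<eta>"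
    and prod_linear_right:
      "\<lbrakk>\<tau> \<in> forms M p; \<eta> \<in> forms M q; \<eta>' \<in> forms M q\<rbrakk>
        \<Longrightarrow> P \<tau> (scale_form r \<eta> + \<eta>') = scale_series r (P \<tau> \<eta>) + P \<tau> \<eta>'"
    and prod_classical:
      "\<lbrakk>\<tau> \<in> forms M p; \<eta> \<in> forms M q\<rbrakk> \<Longrightarrow> eq_upto 1 (P \<tau> \<eta>) (cst (wedge \<tau> \<eta>))"
    and fun_associative:
      "\<lbrakk>x \<in> forms M 0; y \<in> forms M 0; z \<in> forms M 0\<rbrakk>
        \<Longrightarrow> ext_prod P (P x y) (cst z) = ext_prod P (cst x) (P y z)"
    and associative:
      "\<lbrakk>\<tau> \<in> forms M p; \<eta> \<in> forms M q; \<zeta> \<in> forms M s\<rbrakk>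
        \<Longrightarrow> eq_upto 2 (ext_prod P (P \<tau> \<eta>) (cst \<zeta>)) (ext_prod P (cst \<tau>) (P \<eta> \<zeta>))"
    and diff_closed:
      "\<tau> \<in> forms M p \<Longrightarrow> fps_nth (D \<tau>) k \<in> forms M (Suc p)"
    and diff_linear:
      "\<lbrakk>\<tau> \<in> forms M p; \<tau>' \<in> forms M p\<rbrakk>
        \<Longrightarrow> D (scale_form r \<tau> + \<tau>') = scale_series r (D \<tau>) + D \<tau>'"
    and diff_classical:
      "\<tau> \<in> forms M p \<Longrightarrow> eq_upto 1 (D \<tau>) (cst (ext_d M \<tau>))"
    and diff_derivation:
      "\<lbrakk>\<tau> \<in> forms M p; \<eta> \<in> forms M q\<rbrakk>
        \<Longrightarrow> eq_upto 2 (ext_op D (P \<tau> \<eta>))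
              (ext_prod P (D \<tau>) (cst \<eta>) + scale_series ((- 1) ^ p) (ext_prod P (cst \<tau>) (D \<eta>)))"

text \<open>
  The super-commutator of (series of) forms of degrees \<open>p\<close> and \<open>q\<close>; the degrees are arguments
  since the zero form has every degree.
\<close>

definition scomm :: "('a form \<Rightarrow> 'a form \<Rightarrow> 'a form fps) \<Rightarrow> nat \<Rightarrow> nat
    \<Rightarrow> 'a form fps \<Rightarrow> 'a form fps \<Rightarrow> 'a form fps" where
  "scomm P p q a b = ext_prod P a b - scale_series ((- 1) ^ (p * q)) (ext_prod P b a)"

text \<open>
  The Poisson bracket and the preconnection are the \<open>\<hbar>\<close>-coefficients of the commutators
  \<open>[x, y]\<^sub>\<bullet>\<close> and \<open>[x, \<tau>]\<^sub>\<bullet>\<close>.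
\<close>

definition poisson ::
    "('a form \<Rightarrow> 'a form \<Rightarrow> 'a form fps) \<Rightarrow> 'a form \<Rightarrow> 'a form \<Rightarrow> 'a form" where
  "poisson P x y = fps_nth (scomm P 0 0 (cst x) (cst y)) 1"

definition preconnection ::
    "('a form \<Rightarrow> 'a form \<Rightarrow> 'a form fps) \<Rightarrow> 'a form \<Rightarrow> 'a form \<Rightarrow> 'a form" where
  "preconnection P x \<tau> = fps_nth (scomm P 0 1 (cst x) (cst \<tau>)) 1"

text \<open>
  The curvature written \<open>R(\<^bold>x, \<^bold>y)(\<tau>)\<close> for the Hamiltonian vector fields \<open>\<^bold>x = {x, -}\<close>,
  \<open>\<^bold>y = {y, -}\<close>; it is a function of \<open>x\<close> and \<open>y\<close>, as is the operator \<open>preconnection P x\<close>.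
\<close>

definition curvature ::
    "('a form \<Rightarrow> 'a form \<Rightarrow> 'a form fps) \<Rightarrow> 'a form \<Rightarrow> 'a form \<Rightarrow> 'a form \<Rightarrow> 'a form" where
  "curvature P x y \<tau> =
     preconnection P x (preconnection P y \<tau>) - preconnection P y (preconnection P x \<tau>)
     - preconnection P (poisson P x y) \<tau>"

text \<open>The left-hand side of the first super Jacobi identity, for functions \<open>x\<close>, \<open>y\<close> and a 1-form \<open>\<tau>\<close>.\<close>

definition jacobiator ::
    "('a form \<Rightarrow> 'a form \<Rightarrow> 'a form fps) \<Rightarrow> 'a form \<Rightarrow> 'a form \<Rightarrow> 'a form \<Rightarrow> 'a form fps" where
  "jacobiator P x y \<tau> =
     scomm P 0 1 (cst x) (scomm P 0 1 (cst y) (cst \<tau>)) +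
     scomm P 1 0 (cst \<tau>) (scomm P 0 0 (cst x) (cst y)) +
     scomm P 0 1 (cst y) (scomm P 1 0 (cst \<tau>) (cst x))"

definition J1 :: "'a manifold \<Rightarrow> ('a form \<Rightarrow> 'a form \<Rightarrow> 'a form fps)
    \<Rightarrow> 'a form \<Rightarrow> 'a form \<Rightarrow> 'a form \<Rightarrow> 'a form" where
  "J1 M P x y z = fps_nth (jacobiator P x y (ext_d M z)) 2"

end

theory Submission imports Defs begin

text \<open>
  The result is a statement about lowest orders in \<open>\<hbar>\<close>. Classically a function commutes with every
  form, so a commutator with a function has no \<open>\<hbar>\<^sup>0\<close> term, and each bracket contributes at least one
  power of \<open>\<hbar>\<close>. Hence an iterated bracket starts in order \<open>\<hbar>\<^sup>2\<close>, and its \<open>\<hbar>\<^sup>2\<close> coefficient arises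
  only by feeding the \<open>\<hbar>\<^sup>1\<close> coefficient of the inner bracket into the \<open>\<hbar>\<^sup>1\<close> part of the outer one
  (\<open>nested_scomm_lowest_order\<close>). The \<open>\<hbar>\<^sup>1\<close> coefficients are the preconnection \<open>\<gamma>\<close> and the Poisson
  bracket, so by antisymmetry of the commutator and linearity of \<open>\<gamma>(y, -)\<close> the three iterated
  brackets are, modulo \<open>\<hbar>\<^sup>3\<close>,
  \<open>\<hbar>\<^sup>2 \<gamma>(x, \<gamma>(y, \<tau>))\<close>, \<open>- \<hbar>\<^sup>2 \<gamma>({x, y}, \<tau>)\<close> and \<open>- \<hbar>\<^sup>2 \<gamma>(y, \<gamma>(x, \<tau>))\<close>,
  which add up to the curvature (\<open>jacobiator_lowest_order\<close>). The claim about \<open>J\<^sub>1\<close> is the case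
  \<open>\<tau> = dz\<close>.

  To apply this to an inner bracket, all its coefficients have to be forms. They are differences of
  forms, so real linear combinations of forms must be forms, which reduces to smooth functions in
  charts.
\<close>

section \<open>Differential forms as a real vector space\<close>

lemma eventually_coordinate_line:
  assumes V: "openin (Euclidean_space n) V" and x: "x \<in> V" and i: "i < n"
  shows "eventually (\<lambda>t. x(i := t) \<in> V) (nhds (x i))"
proof -
  have x0: "x j = 0" if "j \<ge> n" for j
    using openin_subset[OF V] x that by (auto simp: topspace_Euclidean_space)
  have "continuous_map euclideanreal (Euclidean_space n) (\<lambda>t. x(i := t))"
    unfolding Euclidean_space_def continuous_map_in_subtopology continuous_map_componentwise_UNIV
    using x0 i by (auto simp: fun_upd_def)
  from openin_continuous_map_preimage[OF this V] have "open {t. x(i := t) \<in> V}"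
    by simp
  then show ?thesis
    using x eventually_nhds_in_open[of "{t. x(i := t) \<in> V}" "x i"] by simp
qed

text \<open>
  The predicate refers to lines through points of \<open>V\<close>, which may leave \<open>V\<close>; openness ensures that
  the values near a point, and hence the partial derivatives, are determined by the values on \<open>V\<close>.
\<close>

lemma smooth_upto_cong:
  assumes V: "openin (Euclidean_space n) V"
    and "\<And>x. x \<in> V \<Longrightarrow> f x = g x" and "smooth_upto k n V f"
  shows "smooth_upto k n V g"
  using assms(2,3)
proof (induction k arbitrary: f g)
  case 0
  then show ?case
    by (auto intro: continuous_map_eq)
next
  case (Suc k)
  have near: "eventually (\<lambda>t. f (x(i := t)) = g (x(i := t))) (nhds (x i))"
    if "x \<in> V" "i < n" for x i
    using eventually_coordinate_line[OF V that] by eventually_elim (use Suc.prems(1) in auto)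
  have "continuous_map (subtopology (Euclidean_space n) V) euclideanreal g"
    using Suc.prems by (auto intro: continuous_map_eq)
  moreover have "(\<lambda>t. g (x(i := t))) field_differentiable at (x i)" if "x \<in> V" "i < n" for x i
  proof -
    obtain c where "((\<lambda>t. f (x(i := t))) has_field_derivative c) (at (x i))"
      using Suc.prems(2) \<open>x \<in> V\<close> \<open>i < n\<close> by (auto simp: field_differentiable_def)
    then have "((\<lambda>t. g (x(i := t))) has_field_derivative c) (at (x i))"
      using DERIV_cong_ev[OF refl near[OF that] refl] by simp
    then show ?thesis
      by (auto simp: field_differentiable_def)
  qed
  moreover have "smooth_upto k n V (\<lambda>x. deriv (\<lambda>t. g (x(i := t))) (x i))" if "i < n" for i
    using Suc.IH[of "\<lambda>x. deriv (\<lambda>t. f (x(i := t))) (x i)"] Suc.prems(2) that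
      deriv_cong_ev[OF near refl] by simp
  ultimately show ?case
    by simp
qed

lemma smooth_upto_linear_combination:
  assumes V: "openin (Euclidean_space n) V"
    and "smooth_upto k n V f" "smooth_upto k n V g"
  shows "smooth_upto k n V (\<lambda>x. r * f x + g x)"
  using assms(2,3)
proof (induction k arbitrary: f g)
  case 0
  then show ?case
    by (auto intro!: continuous_map_add continuous_map_real_mult_left)
next
  case (Suc k)
  have diff: "(\<lambda>t. f (x(i := t))) field_differentiable at (x i)"
      "(\<lambda>t. g (x(i := t))) field_differentiable at (x i)" if "x \<in> V" "i < n" for x i
    using Suc.prems that by auto
  have "deriv (\<lambda>t. r * f (x(i := t)) + g (x(i := t))) (x i) =
      r * deriv (\<lambda>t. f (x(i := t))) (x i) + deriv (\<lambda>t. g (x(i := t))) (x i)"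
    if "x \<in> V" "i < n" for x i
    using diff[OF that]
    by (auto intro!: DERIV_imp_deriv derivative_eq_intros dest: field_differentiable_derivI)
  \<comment> \<open>The partial derivatives of the sum and the sum of the partial derivatives agree on \<open>V\<close> only:
    elsewhere the functions need not be differentiable.\<close>
  then have "smooth_upto k n V (\<lambda>x. deriv (\<lambda>t. r * f (x(i := t)) + g (x(i := t))) (x i))"
    if "i < n" for i
    using smooth_upto_cong[OF V _ Suc.IH[of "\<lambda>x. deriv (\<lambda>t. f (x(i := t))) (x i)"
          "\<lambda>x. deriv (\<lambda>t. g (x(i := t))) (x i)"]] Suc.prems that
    by simp
  then show ?case
    using Suc.prems diff
    by (auto intro!: continuous_map_add continuous_map_real_mult_left
        field_differentiable_add field_differentiable_mult field_differentiable_const)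
qed

lemma smooth_functions_linear_combination:
  assumes "smooth_manifold M" "f \<in> smooth_functions M" "g \<in> smooth_functions M"
  shows "(\<lambda>p. r * f p + g p) \<in> smooth_functions M"
proof -
  have "smooth_in (mdim M) (\<phi> ` U) (\<lambda>u. r * f (inv_into U \<phi> u) + g (inv_into U \<phi> u))"
    if "(U, \<phi>) \<in> atlas M" for U \<phi>
  proof -
    have "is_chart M (U, \<phi>)"
      using assms(1) that unfolding smooth_manifold_def by blast
    then have "openin (Euclidean_space (mdim M)) (\<phi> ` U)"
      by (simp add: is_chart_def)
    moreover have "smooth_in (mdim M) (\<phi> ` U) (\<lambda>u. f (inv_into U \<phi> u))"
      and "smooth_in (mdim M) (\<phi> ` U) (\<lambda>u. g (inv_into U \<phi> u))"
      using assms(2,3) that by (auto simp: smooth_functions_def)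
    ultimately show ?thesis
      by (simp add: smooth_in_def smooth_upto_linear_combination)
  qed
  then show ?thesis
    using assms(2,3) by (auto simp: smooth_functions_def)
qed

lemma forms_linear_combination:
  assumes M: "smooth_manifold M" and a: "\<alpha> \<in> forms M n" and b: "\<beta> \<in> forms M n"
  shows "scale_form r \<alpha> + \<beta> \<in> forms M n"
proof -
  have eval: "(scale_form r \<alpha> + \<beta>) vs = (\<lambda>p. r * \<alpha> vs p + \<beta> vs p)" for vs
    by (auto simp: scale_form_def)
  show ?thesis
    unfolding forms_def mem_Collect_eq eval
  proof (intro conjI allI impI ballI)
    fix vs assume "length vs = n \<and> set vs \<subseteq> vector_fields M"
    then show "(\<lambda>p. r * \<alpha> vs p + \<beta> vs p) \<in> smooth_functions M"
      using a b by (intro smooth_functions_linear_combination[OF M]) (auto simp: forms_def)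
  next
    fix vs i v w f
    assume vs: "length vs = n \<and> set vs \<subseteq> vector_fields M" and "i < n"
      and "v \<in> vector_fields M" "w \<in> vector_fields M" "f \<in> smooth_functions M"
    then have
      "\<alpha> (vs[i := (\<lambda>g. f * v g + w g)]) = f * \<alpha> (vs[i := v]) + \<alpha> (vs[i := w])"
      "\<beta> (vs[i := (\<lambda>g. f * v g + w g)]) = f * \<beta> (vs[i := v]) + \<beta> (vs[i := w])"
      using a b unfolding forms_def by blast+
    then show "(\<lambda>p. r * \<alpha> (vs[i := (\<lambda>g. f * v g + w g)]) p + \<beta> (vs[i := (\<lambda>g. f * v g + w g)]) p) =
        f * (\<lambda>p. r * \<alpha> (vs[i := v]) p + \<beta> (vs[i := v]) p) +
        (\<lambda>p. r * \<alpha> (vs[i := w]) p + \<beta> (vs[i := w]) p)"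
      by (simp add: fun_eq_iff algebra_simps)
  qed (use a b in \<open>auto simp: forms_def\<close>)
qed

lemma scale_form_minus_one: "scale_form (- 1) \<alpha> = - \<alpha>"
  by (auto simp: scale_form_def fun_eq_iff)

lemma scale_series_one: "scale_series 1 A = A"
  by (simp add: scale_series_def scale_form_def fps_eq_iff)

lemma scale_series_minus_one: "scale_series (- 1) A = - A"
  by (simp add: scale_series_def scale_form_minus_one fps_eq_iff)

lemma forms_diff:
  assumes "smooth_manifold M" "\<alpha> \<in> forms M n" "\<beta> \<in> forms M n"
  shows "\<alpha> - \<beta> \<in> forms M n"
  using forms_linear_combination[OF assms(1,3,2), of "- 1"] by (simp add: scale_form_minus_one)

section \<open>Lowest orders of the commutator with a function\<close>

lemma function_nths_zero:
  assumes "x \<in> forms M 0" "i \<in> S" "i < length vs"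
  shows "x (nths vs S) = 0"
proof -
  have "vs ! i \<in> set (nths vs S)"
    using assms(2,3) by (auto simp: set_nths)
  then have "length (nths vs S) \<noteq> 0"
    by auto
  then show ?thesis
    using assms(1) by (auto simp: forms_def)
qed

text \<open>
  A \<open>0\<close>-form vanishes on nonempty lists, so a single shuffle survives in a wedge product with a
  function: the one that feeds all the vector fields to the other factor. It has no inversions,
  whence the two products agree without a sign.
\<close>

lemma wedge_function_left:
  assumes "x \<in> forms M 0"
  shows "wedge x \<tau> = (\<lambda>vs p. x [] p * \<tau> vs p)"
proof (intro ext)
  fix vs p
  let ?summand = "\<lambda>S. (- 1) ^ card {(i, j). i \<in> S \<and> j \<in> {..<length vs} - S \<and> j < i} *
    x (nths vs S) p * \<tau> (nths vs (- S)) p"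
  have "sum ?summand (Pow {..<length vs}) = sum ?summand {{}}"
    by (rule sum.mono_neutral_right) (auto simp: function_nths_zero[OF assms])
  then show "wedge x \<tau> vs p = x [] p * \<tau> vs p"
    by (simp add: wedge_def nths_all)
qed

lemma wedge_function_right:
  assumes "x \<in> forms M 0"
  shows "wedge \<tau> x = (\<lambda>vs p. x [] p * \<tau> vs p)"
proof (intro ext)
  fix vs p
  let ?summand = "\<lambda>S. (- 1) ^ card {(i, j). i \<in> S \<and> j \<in> {..<length vs} - S \<and> j < i} *
    \<tau> (nths vs S) p * x (nths vs (- S)) p"
  have "x (nths vs (- S)) p = 0" if S: "S \<subset> {..<length vs}" for S
  proof -
    obtain i where "i \<in> - S" "i < length vs"
      using psubset_imp_ex_mem[OF S] by auto
    then show ?thesis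
      by (simp add: function_nths_zero[OF assms])
  qed
  then have "sum ?summand (Pow {..<length vs}) = sum ?summand {{..<length vs}}"
    by (intro sum.mono_neutral_right) auto
  moreover have "set (nths vs (- {..<length vs})) = {}"
    by (auto simp: set_nths)
  ultimately show "wedge \<tau> x vs p = x [] p * \<tau> vs p"
    by (simp add: wedge_def nths_all)
qed

lemma fps_nth_hbar: "fps_nth (hbar k \<alpha>) j = (if j = k then \<alpha> else 0)"
  by (simp add: hbar_def)

context calculus_deformation
begin

lemma prod_diff_left:
  assumes "\<alpha> \<in> forms M p" "\<beta> \<in> forms M p" "\<eta> \<in> forms M q"
  shows "P (\<alpha> - \<beta>) \<eta> = P \<alpha> \<eta> - P \<beta> \<eta>"
  using prod_linear_left[OF assms(2,1,3), of "- 1"]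
  by (simp add: scale_form_minus_one scale_series_minus_one)

lemma prod_diff_right:
  assumes "\<tau> \<in> forms M p" "\<alpha> \<in> forms M q" "\<beta> \<in> forms M q"
  shows "P \<tau> (\<alpha> - \<beta>) = P \<tau> \<alpha> - P \<tau> \<beta>"
  using prod_linear_right[OF assms(1,3,2), of "- 1"]
  by (simp add: scale_form_minus_one scale_series_minus_one)

text \<open>
  The exterior derivative is the \<open>\<hbar>\<^sup>0\<close> coefficient of \<open>d\<^sup>\<bullet>\<close>, whose coefficients are forms.
\<close>

lemma ext_d_forms:
  assumes "\<omega> \<in> forms M p"
  shows "ext_d M \<omega> \<in> forms M (Suc p)"
  using diff_classical[OF assms] diff_closed[OF assms, of 0]
  by (simp add: eq_upto_def fps_nth_hbar)

end

locale smooth_calculus_deformation = calculus_deformation M P D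
  for M :: "'a manifold"
    and P :: "'a form \<Rightarrow> 'a form \<Rightarrow> 'a form fps"
    and D :: "'a form \<Rightarrow> 'a form fps" +
  assumes manifold: "smooth_manifold M"
begin

lemma zero_form: "\<tau> \<in> forms M p \<Longrightarrow> 0 \<in> forms M p"
  using forms_diff[OF manifold, of \<tau> p \<tau>] by simp

lemma uminus_form: "\<tau> \<in> forms M p \<Longrightarrow> - \<tau> \<in> forms M p"
  using forms_diff[OF manifold zero_form, of \<tau> p \<tau>] by simp

lemma prod_zero_left:
  assumes "\<tau> \<in> forms M p" "\<eta> \<in> forms M q"
  shows "P 0 \<eta> = 0"
  using prod_diff_left[OF assms(1,1,2)] by simp

lemma prod_zero_right:
  assumes "\<tau> \<in> forms M p" "\<eta> \<in> forms M q"
  shows "P \<tau> 0 = 0"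
  using prod_diff_right[OF assms(1,2,2)] by simp

lemma ext_prod_cst_left:
  assumes "\<tau> \<in> forms M p" "\<And>j. fps_nth B j \<in> forms M q"
  shows "fps_nth (ext_prod P (cst \<tau>) B) n = (\<Sum>j\<le>n. fps_nth (P \<tau> (fps_nth B j)) (n - j))"
proof -
  have "fps_nth (ext_prod P (cst \<tau>) B) n = (\<Sum>i\<le>n. if i = 0 then
      \<Sum>j\<le>n. fps_nth (P \<tau> (fps_nth B j)) (n - j) else 0)"
    unfolding ext_prod_def fps_nth_Abs_fps
    by (rule sum.cong) (simp_all add: fps_nth_hbar prod_zero_left[OF assms])
  then show ?thesis
    by simp
qed

lemma ext_prod_cst_right:
  assumes "\<And>i. fps_nth A i \<in> forms M p" "\<eta> \<in> forms M q"
  shows "fps_nth (ext_prod P A (cst \<eta>)) n = (\<Sum>i\<le>n. fps_nth (P (fps_nth A i) \<eta>) (n - i))"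
  unfolding ext_prod_def fps_nth_Abs_fps
proof (rule sum.cong[OF refl])
  fix i
  have "(\<Sum>j\<le>n - i. fps_nth (P (fps_nth A i) (fps_nth (cst \<eta>) j)) (n - i - j)) =
      (\<Sum>j\<le>n - i. if j = 0 then fps_nth (P (fps_nth A i) \<eta>) (n - i) else 0)"
    by (rule sum.cong) (simp_all add: fps_nth_hbar prod_zero_right[OF assms])
  then show "(\<Sum>j\<le>n - i. fps_nth (P (fps_nth A i) (fps_nth (cst \<eta>) j)) (n - i - j)) =
      fps_nth (P (fps_nth A i) \<eta>) (n - i)"
    by simp
qed

text \<open>
  A degree \<open>0\<close> on either side makes the super-sign \<open>(-1)\<^sup>p\<^sup>q\<close> equal to \<open>1\<close>, so that the
  super-commutator is an ordinary commutator.
\<close>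

lemma scomm_cst:
  assumes "p = 0 \<or> q = 0" "\<tau> \<in> forms M p" "\<And>j. fps_nth B j \<in> forms M q"
  shows "fps_nth (scomm P p q (cst \<tau>) B) n =
    (\<Sum>j\<le>n. fps_nth (P \<tau> (fps_nth B j) - P (fps_nth B j) \<tau>) (n - j))"
proof -
  have "(- 1) ^ (p * q) = (1 :: real)"
    using assms(1) by auto
  then show ?thesis
    by (simp add: scomm_def scale_series_one ext_prod_cst_left[OF assms(2,3)]
        ext_prod_cst_right[OF assms(3,2)] sum_subtractf)
qed

lemma scomm_forms:
  assumes "p = 0 \<or> q = 0" "\<tau> \<in> forms M p" "\<eta> \<in> forms M q"
  shows "scomm P p q (cst \<tau>) (cst \<eta>) = P \<tau> \<eta> - P \<eta> \<tau>"
proof (rule fps_ext)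
  fix n
  have "fps_nth (cst \<eta>) j \<in> forms M q" for j
    using assms(3) zero_form by (simp add: fps_nth_hbar)
  then have "fps_nth (scomm P p q (cst \<tau>) (cst \<eta>)) n = (\<Sum>j\<le>n.
      if j = 0 then fps_nth (P \<tau> \<eta> - P \<eta> \<tau>) n else 0)"
    by (subst scomm_cst[OF assms(1,2)], assumption, intro sum.cong)
      (simp_all add: fps_nth_hbar prod_zero_left[OF assms(3,2)] prod_zero_right[OF assms(2,3)])
  then show "fps_nth (scomm P p q (cst \<tau>) (cst \<eta>)) n = fps_nth (P \<tau> \<eta> - P \<eta> \<tau>) n"
    by simp
qed

lemma scomm_swap:
  assumes "p = 0 \<or> q = 0" "\<tau> \<in> forms M p" "\<eta> \<in> forms M q"
  shows "scomm P q p (cst \<eta>) (cst \<tau>) = - scomm P p q (cst \<tau>) (cst \<eta>)"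
  using scomm_forms[OF assms] scomm_forms[of q p \<eta> \<tau>] assms by auto

lemma scomm_closed:
  assumes "p = 0 \<or> q = 0" "\<tau> \<in> forms M p" "\<eta> \<in> forms M q"
  shows "fps_nth (scomm P p q (cst \<tau>) (cst \<eta>)) k \<in> forms M (p + q)"
  using prod_closed[OF assms(2,3)] prod_closed[OF assms(3,2)]
  by (simp add: scomm_forms[OF assms] forms_diff[OF manifold] add.commute)

lemma prod_commute_classical:
  assumes "p = 0 \<or> q = 0" "\<tau> \<in> forms M p" "\<eta> \<in> forms M q"
  shows "fps_nth (P \<tau> \<eta>) 0 = fps_nth (P \<eta> \<tau>) 0"
proof -
  have "wedge \<tau> \<eta> = wedge \<eta> \<tau>"
    using assms by (auto simp: wedge_function_left wedge_function_right)
  then show ?thesis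
    using prod_classical[OF assms(2,3)] prod_classical[OF assms(3,2)]
    by (simp add: eq_upto_def fps_nth_hbar)
qed

lemma scomm_classical:
  assumes "p = 0 \<or> q = 0" "\<tau> \<in> forms M p" "\<eta> \<in> forms M q"
  shows "fps_nth (scomm P p q (cst \<tau>) (cst \<eta>)) 0 = 0"
  by (simp add: scomm_forms[OF assms] prod_commute_classical[OF assms])

text \<open>
  With \<open>B = \<hbar> B\<^sub>1 + \<hbar>\<^sup>2 B\<^sub>2 + O(\<hbar>\<^sup>3)\<close>, the term \<open>\<hbar>\<^sup>2 B\<^sub>2\<close> could contribute to order \<open>\<hbar>\<^sup>2\<close> only through
  its classical commutator with \<open>\<tau>\<close>, which is zero, and the same holds for \<open>\<hbar> B\<^sub>1\<close> in order \<open>\<hbar>\<close>.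
\<close>

lemma scomm_lowest_order:
  assumes pq: "p = 0 \<or> q = 0" and \<tau>: "\<tau> \<in> forms M p"
    and B: "\<And>j. fps_nth B j \<in> forms M q" and B0: "fps_nth B 0 = 0"
  shows "eq_upto 3 (scomm P p q (cst \<tau>) B)
    (hbar 2 (fps_nth (scomm P p q (cst \<tau>) (cst (fps_nth B 1))) 1))"
proof -
  have "P \<tau> (fps_nth B 0) = 0" "P (fps_nth B 0) \<tau> = 0"
    using prod_zero_left[OF B \<tau>] prod_zero_right[OF \<tau> B] by (simp_all add: B0)
  then have "fps_nth (scomm P p q (cst \<tau>) B) n =
      fps_nth (hbar 2 (fps_nth (scomm P p q (cst \<tau>) (cst (fps_nth B 1))) 1)) n" if "n < 3" for n
    using that prod_commute_classical[OF pq \<tau> B]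
    by (auto simp: scomm_cst[OF pq \<tau> B] scomm_forms[OF pq \<tau> B] fps_nth_hbar less_Suc_eq
        numeral_3_eq_3 numeral_2_eq_2)
  then show ?thesis
    by (simp add: eq_upto_def)
qed

lemma nested_scomm_lowest_order:
  assumes "p = 0 \<or> q + s = 0" "q = 0 \<or> s = 0"
    and "\<tau> \<in> forms M p" "\<eta> \<in> forms M q" "\<zeta> \<in> forms M s"
  shows "eq_upto 3 (scomm P p (q + s) (cst \<tau>) (scomm P q s (cst \<eta>) (cst \<zeta>)))
    (hbar 2 (fps_nth (scomm P p (q + s) (cst \<tau>)
      (cst (fps_nth (scomm P q s (cst \<eta>) (cst \<zeta>)) 1))) 1))"
  by (rule scomm_lowest_order[OF assms(1,3) scomm_closed[OF assms(2,4,5)]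
        scomm_classical[OF assms(2,4,5)]])

section \<open>Iterated commutators and curvature\<close>

lemma preconnection_closed:
  "\<lbrakk>x \<in> forms M 0; \<tau> \<in> forms M 1\<rbrakk> \<Longrightarrow> preconnection P x \<tau> \<in> forms M 1"
  using scomm_closed[of 0 1 x \<tau> 1] by (simp add: preconnection_def)

lemma poisson_closed:
  "\<lbrakk>x \<in> forms M 0; y \<in> forms M 0\<rbrakk> \<Longrightarrow> poisson P x y \<in> forms M 0"
  using scomm_closed[of 0 0 x y 1] by (simp add: poisson_def)

lemma preconnection_uminus:
  assumes "x \<in> forms M 0" "\<tau> \<in> forms M 1"
  shows "preconnection P x (- \<tau>) = - preconnection P x \<tau>"
proof -
  have "P x (- \<tau>) = - P x \<tau>" "P (- \<tau>) x = - P \<tau> x"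
    using prod_diff_right[OF assms(1) zero_form assms(2)] prod_zero_right[OF assms(1,2)]
      prod_diff_left[OF zero_form assms(2,1)] prod_zero_left[OF assms(2,1)] assms by auto
  then show ?thesis
    using assms uminus_form[OF assms(2)] by (simp add: preconnection_def scomm_forms)
qed

lemma scomm_form_function:
  assumes "x \<in> forms M 0" "\<tau> \<in> forms M 1"
  shows "fps_nth (scomm P 1 0 (cst \<tau>) (cst x)) 1 = - preconnection P x \<tau>"
  using scomm_swap[of 0 1 x \<tau>] assms by (simp add: preconnection_def)

text \<open>
  The minus signs of the curvature come from the brackets with \<open>\<tau>\<close> in the first slot, where the
  preconnection expects the function: the outer one in \<open>[\<tau>, [x, y]]\<close>, the inner one in \<open>[y, [\<tau>, x]]\<close>.
\<close>

lemma jacobiator_lowest_order: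
  assumes x: "x \<in> forms M 0" and y: "y \<in> forms M 0" and \<tau>: "\<tau> \<in> forms M 1"
  shows "eq_upto 3 (jacobiator P x y \<tau>) (hbar 2 (curvature P x y \<tau>))"
proof -
  have "eq_upto 3 (scomm P 0 1 (cst x) (scomm P 0 1 (cst y) (cst \<tau>)))
      (hbar 2 (preconnection P x (preconnection P y \<tau>)))"
    using nested_scomm_lowest_order[of 0 0 1 x y \<tau>] x y \<tau> by (simp add: preconnection_def)
  moreover have "eq_upto 3 (scomm P 1 0 (cst \<tau>) (scomm P 0 0 (cst x) (cst y)))
      (hbar 2 (- preconnection P (poisson P x y) \<tau>))"
    using nested_scomm_lowest_order[of 1 0 0 \<tau> x y] x y \<tau>
      scomm_form_function[OF poisson_closed[OF x y] \<tau>] by (simp add: poisson_def)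
  moreover have "eq_upto 3 (scomm P 0 1 (cst y) (scomm P 1 0 (cst \<tau>) (cst x)))
      (hbar 2 (- preconnection P y (preconnection P x \<tau>)))"
    using nested_scomm_lowest_order[of 0 1 0 y \<tau> x] x y \<tau>
      preconnection_uminus[OF y preconnection_closed[OF x \<tau>]] scomm_form_function[OF x \<tau>]
    by (simp add: preconnection_def)
  ultimately show ?thesis
    by (auto simp: eq_upto_def jacobiator_def curvature_def fps_nth_hbar)
qed

end

theorem proposition3p1:
  fixes M :: "'a manifold"
    and P :: "'a form \<Rightarrow> 'a form \<Rightarrow> 'a form fps"
    and D :: "'a form \<Rightarrow> 'a form fps"
  assumes "smooth_manifold M"
    and "calculus_deformation M P D"
  shows "(\<forall>x\<in>forms M 0. \<forall>y\<in>forms M 0. \<forall>\<tau>\<in>forms M 1.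
            eq_upto 3
              (scomm P 0 1 (cst x) (scomm P 0 1 (cst y) (cst \<tau>)) +
               scomm P 1 0 (cst \<tau>) (scomm P 0 0 (cst x) (cst y)) +
               scomm P 0 1 (cst y) (scomm P 1 0 (cst \<tau>) (cst x)))
              (hbar 2 (curvature P x y \<tau>))) \<and>
         (\<forall>x\<in>forms M 0. \<forall>y\<in>forms M 0. \<forall>z\<in>forms M 0.
            eq_upto 3 (jacobiator P x y (ext_d M z)) (hbar 2 (J1 M P x y z)) \<and>
            J1 M P x y z = curvature P x y (ext_d M z))"
proof -
  interpret smooth_calculus_deformation M P D
    using assms by (intro smooth_calculus_deformation.intro smooth_calculus_deformation_axioms.intro)
  have "J1 M P x y z = curvature P x y (ext_d M z)"
    and "eq_upto 3 (jacobiator P x y (ext_d M z)) (hbar 2 (curvature P x y (ext_d M z)))"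
    if "x \<in> forms M 0" "y \<in> forms M 0" "z \<in> forms M 0" for x y z
  proof -
    show *: "eq_upto 3 (jacobiator P x y (ext_d M z)) (hbar 2 (curvature P x y (ext_d M z)))"
      using jacobiator_lowest_order that ext_d_forms[of z 0] by simp
    then show "J1 M P x y z = curvature P x y (ext_d M z)"
      by (simp add: J1_def eq_upto_def fps_nth_hbar)
  qed
  then show ?thesis
    using jacobiator_lowest_order by (simp add: jacobiator_def)
qed

end
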